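(* Let $\mathcal{B}\subset\mathcal{Z}$ be an open set and let $\mathcal{J}\in C^1(\mathcal{B};\mathbb{R})$ be $\lambda$-strongly convex for a given $\lambda>0$, i.e. $$\mathcal{J}(z_2)\ge \mathcal{J}(z_1)+\langle D_z\mathcal{J}(z_1),z_2-z_1\rangle_{\mathcal{Z}'\times\mathcal{Z}}+\frac{\lambda}{2}\|z_2-z_1\|_{\mathcal{Z}}^2\qquad\text{for all } z_1,z_2\in\mathcal{B}.$$ Let $\mathcal{Z}_{ad}\subset\mathcal{B}$ be a closed, convex and nonempty set, and let $z^{\star}$ be the unique minimizer of $\mathcal{J}$ over $\mathcal{Z}_{ad}$. Let $\mathcal{J}_\theta\in C^1(\mathcal{B};\mathbb{R})$ (an approximation of $\mathcal{J}$) and let $z^{\dagger}\in\mathcal{Z}_{ad}$ be any point satisfying the first-order optimality conditions $$\langle D_z\mathcal{J}_\theta(z^{\dagger}),z-z^{\dagger}\rangle_{\mathcal{Z}'\times\mathcal{Z}}\ge 0\qquad\text{for all } z\in\mathcal{Z}_{ad}.$$ Then $$\|z^{\star}-z^{\dagger}\|_{\mathcal{Z}}\le\frac1\lambda\,\|D_z\mathcal{J}(z^{\dagger})-D_z\mathcal{J}_\theta(z^{\dagger})\|_{\mathcal{Z}'}$$ and $$\mathcal{J}(z^{\dagger})-\mathcal{J}(z^{\star})\le\frac{1}{2\lambda}\,\|D_z\mathcal{J}(z^{\dagger})-D_z\mathcal{J}_\theta(z^{\dagger})\|_{\mathcal{Z}'}^2 .$$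
   Context: $\mathcal{Z}=\mathbb{R}^{d_z}$ is a finite-dimensional real Hilbert space with norm $\|\cdot\|_{\mathcal{Z}}$; $\mathcal{Z}'$ is its topological dual with the dual norm and $\langle\cdot,\cdot\rangle_{\mathcal{Z}'\times\mathcal{Z}}$ is the duality pairing. $D_z$ denotes the Fréchet derivative, and $C^1(\mathcal{B};\mathbb{R})$ is the space of continuously Fréchet differentiable real-valued functions on $\mathcal{B}$. *)

theory Defs
  imports "HOL-Analysis.Analysis"
begin

text \<open>
  The space \<open>\<Z>\<close> is an arbitrary type of class \<^class>\<open>euclidean_space\<close>, i.e. an arbitrary
  finite-dimensional real Hilbert space. Its topological dual is \<open>'a \<Rightarrow>\<^sub>L real\<close>, the norm of that
  type is the dual norm, and \<^const>\<open>blinfun_apply\<close> is the duality pairing.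
\<close>

text \<open>The value is meaningful only where \<open>f\<close> is differentiable; \<open>C1_on\<close> below guarantees this.\<close>

definition frechet_D :: "('a::euclidean_space \<Rightarrow> real) \<Rightarrow> 'a \<Rightarrow> ('a \<Rightarrow>\<^sub>L real)" where
  "frechet_D f z = Blinfun (frechet_derivative f (at z))"

text \<open>Intended for open \<open>B\<close>: the derivative is the one of \<open>f\<close> at \<open>z\<close>, not relative to \<open>B\<close>.\<close>

definition C1_on :: "'a::euclidean_space set \<Rightarrow> ('a \<Rightarrow> real) \<Rightarrow> bool" where
  "C1_on B f \<longleftrightarrow> (\<forall>z\<in>B. f differentiable (at z)) \<and> continuous_on B (frechet_D f)"

definition strongly_convex_on :: "real \<Rightarrow> 'a::euclidean_space set \<Rightarrow> ('a \<Rightarrow> real) \<Rightarrow> bool" where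
  "strongly_convex_on l B f \<longleftrightarrow>
    (\<forall>z1\<in>B. \<forall>z2\<in>B.
       f z2 \<ge> f z1 + blinfun_apply (frechet_D f z1) (z2 - z1) + l / 2 * (norm (z2 - z1))\<^sup>2)"

lemma has_derivative_frechet_D:
  assumes "C1_on B f" "z \<in> B"
  shows "(f has_derivative blinfun_apply (frechet_D f z)) (at z)"
proof -
  have d: "(f has_derivative frechet_derivative f (at z)) (at z)"
    using assms by (auto simp: C1_on_def frechet_derivative_works)
  then show ?thesis
    by (simp add: frechet_D_def bounded_linear_Blinfun_apply has_derivative_bounded_linear)
qed

text \<open>The minimizer of a strongly convex function over an admissible set exists and is unique.\<close>

lemma strongly_convex_on_ex1_minimizer:
  fixes J :: "'a::euclidean_space \<Rightarrow> real"
  assumes C1: "C1_on B J" and l: "l > 0" and sc: "strongly_convex_on l B J"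
    and sub: "Zad \<subseteq> B" and cl: "closed Zad" and cv: "convex Zad" and ne: "Zad \<noteq> {}"
  shows "\<exists>!z. is_arg_min J (\<lambda>z. z \<in> Zad) z"
proof (rule ex_ex1I)
  obtain w where w: "w \<in> Zad" using ne by blast
  define N where "N = norm (frechet_D J w)"
  define K where "K = Zad \<inter> cball w (2 * N / l)"
  have N0: "N \<ge> 0" by (simp add: N_def)
  have wK: "w \<in> K" using w l N0 by (simp add: K_def)
  have "continuous_on B J"
    using C1 unfolding C1_on_def
    by (intro continuous_at_imp_continuous_on ballI differentiable_imp_continuous_within) auto
  then have "continuous_on K J"
    by (rule continuous_on_subset) (use sub K_def in auto)
  moreover have "compact K" unfolding K_def using cl by (intro closed_Int_compact) auto
  ultimately obtain m where m: "m \<in> K" "\<And>y. y \<in> K \<Longrightarrow> J m \<le> J y"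
    using continuous_attains_inf[of K J] wK by blast
  have "J m \<le> J z" if z: "z \<in> Zad" for z
  proof (cases "z \<in> K")
    case False
    define r where "r = norm (z - w)"
    have r: "r > 2 * N / l"
      using False z by (simp add: K_def r_def dist_norm norm_minus_commute)
    then have r0: "r \<ge> 0" and rl: "l * r \<ge> 2 * N"
      using l by (auto simp: r_def field_simps)
    have "\<bar>blinfun_apply (frechet_D J w) (z - w)\<bar> \<le> N * r"
      using norm_blinfun[of "frechet_D J w" "z - w"] by (simp add: N_def r_def)
    moreover have "J z \<ge> J w + blinfun_apply (frechet_D J w) (z - w) + l / 2 * r\<^sup>2"
      using sc w z sub by (auto simp: strongly_convex_on_def r_def)
    moreover have "l / 2 * r\<^sup>2 \<ge> N * r"
      using mult_right_mono[OF rl r0] by (simp add: power2_eq_square algebra_simps)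
    ultimately have "J w \<le> J z" by linarith
    then show ?thesis using m(2)[OF wK] by linarith
  qed (use m in blast)
  then show "\<exists>z. is_arg_min J (\<lambda>z. z \<in> Zad) z"
    using m(1) by (auto simp: is_arg_min_def K_def not_less)
next
  fix a b
  assume a: "is_arg_min J (\<lambda>z. z \<in> Zad) a" and b: "is_arg_min J (\<lambda>z. z \<in> Zad) b"
  define c where "c = (1/2) *\<^sub>R a + (1/2) *\<^sub>R b"
  have ab: "a \<in> Zad" "b \<in> Zad" using a b by (auto simp: is_arg_min_def)
  then have c: "c \<in> Zad" unfolding c_def by (intro convexD[OF cv]) auto
  have "J a \<le> J c" "J b \<le> J c" using a b c by (auto simp: is_arg_min_def not_less)
  moreover have "J a \<ge> J c + blinfun_apply (frechet_D J c) (a - c) + l / 2 * (norm (a - c))\<^sup>2"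
    "J b \<ge> J c + blinfun_apply (frechet_D J c) (b - c) + l / 2 * (norm (b - c))\<^sup>2"
    using sc ab c sub unfolding strongly_convex_on_def by blast+
  moreover have e: "b - c = - (a - c)"
    by (simp add: c_def scaleR_2[symmetric] algebra_simps flip: scaleR_add_left)
  then have "blinfun_apply (frechet_D J c) (b - c) = - blinfun_apply (frechet_D J c) (a - c)"
    "norm (b - c) = norm (a - c)"
    by (simp_all only: blinfun.minus_right norm_minus_cancel)
  ultimately have "l * (norm (a - c))\<^sup>2 \<le> 0" by simp
  then have "a = c" using l by (simp add: mult_le_0_iff)
  then show "a = b" using e by simp
qed

end

theory Submission
  imports Defs
begin

text \<open>
  Strong convexity makes \<open>J\<close> grow quadratically away from its minimizer. Adding this growth estimate
  at \<open>z\<^sup>\<star>\<close> to the strong convexity inequality based at \<open>z\<^sup>\<dagger>\<close>, and inserting the optimality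
  condition for \<open>J\<^sub>\<theta>\<close>, bounds \<open>\<lambda> \<parallel>z\<^sup>\<star> - z\<^sup>\<dagger>\<parallel>\<^sup>2\<close> by the gradient error times
  \<open>\<parallel>z\<^sup>\<star> - z\<^sup>\<dagger>\<parallel>\<close>. The second bound completes the square in the inequality based at \<open>z\<^sup>\<dagger>\<close> alone.
\<close>

text \<open>Minimality is used only through \<open>J x \<le> J c\<close> for points \<open>c\<close>
  of the segment from \<open>x\<close> to \<open>y\<close>, so no first-order condition at
  \<open>x\<close> has to be derived. Strong convexity based at \<open>c\<close> is applied towards
  both endpoints.\<close>

lemma strongly_convex_on_quadratic_growth:
  fixes J :: "'a::euclidean_space \<Rightarrow> real"
  assumes sc: "strongly_convex_on l B J" and sub: "S \<subseteq> B" and cv: "convex S"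
    and min: "is_arg_min J (\<lambda>z. z \<in> S) x" and y: "y \<in> S"
  shows "J x + l / 2 * (norm (y - x))\<^sup>2 \<le> J y"
proof -
  have x: "x \<in> S" using min by (simp add: is_arg_min_def)
  \<comment> \<open>The factor \<open>s\<close> is the weight of \<open>x\<close> in
    \<open>c\<close>; it is removed at the end by letting \<open>s\<close> tend to 1, that is,
    \<open>c\<close> to \<open>x\<close>.\<close>
  have "s * (l / 2 * (norm (y - x))\<^sup>2) \<le> J y - J x" if s: "0 < s" "s < 1" for s
  proof -
    define t where "t = 1 - s"
    have t: "0 < t" "t < 1" "s = 1 - t" using s by (auto simp: t_def)
    define c where "c = (1 - t) *\<^sub>R x + t *\<^sub>R y"
    define D where "D = blinfun_apply (frechet_D J c) (y - x)"
    define q where "q = l / 2 * (norm (y - x))\<^sup>2"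
    have c: "c \<in> S" unfolding c_def using x y t by (intro convexD[OF cv]) auto
    have cx: "x - c = (- t) *\<^sub>R (y - x)" and cy: "y - c = (1 - t) *\<^sub>R (y - x)"
      by (simp_all add: c_def algebra_simps)
    have "J c + blinfun_apply (frechet_D J c) (x - c) + l / 2 * (norm (x - c))\<^sup>2 \<le> J x"
      and "J c + blinfun_apply (frechet_D J c) (y - c) + l / 2 * (norm (y - c))\<^sup>2 \<le> J y"
      using sc c x y sub unfolding strongly_convex_on_def by blast+
    then have "J c - t * D + t\<^sup>2 * q \<le> J x" and "J c + (1 - t) * D + (1 - t)\<^sup>2 * q \<le> J y"
      unfolding cx cy
      by (simp_all only: blinfun.scaleR_right norm_scaleR D_def q_def power_mult_distrib
          power2_abs real_scaleR_def power2_minus mult.assoc mult.left_commute mult_minus_left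
          diff_conv_add_uminus)
    \<comment> \<open>Weighting the inequalities as \<open>x\<close> and \<open>y\<close> are
      weighted in \<open>c\<close> cancels the derivative terms \<open>D\<close>; the quadratic
      terms add up to \<open>t * (1 - t) * q\<close>.\<close>
    then have "(1 - t) * (J c - t * D + t\<^sup>2 * q) + t * (J c + (1 - t) * D + (1 - t)\<^sup>2 * q)
        \<le> (1 - t) * J x + t * J y"
      using t by (intro add_mono mult_left_mono) auto
    moreover have "J x \<le> J c" using min c by (auto simp: is_arg_min_def not_less)
    moreover have "(1 - t) * (J c - t * D + t\<^sup>2 * q) + t * (J c + (1 - t) * D + (1 - t)\<^sup>2 * q)
        = J c + t * (s * q)"
      unfolding \<open>s = 1 - t\<close> by algebra
    ultimately have "t * (s * q) \<le> t * (J y - J x)" by (simp add: algebra_simps)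
    then show ?thesis using t by (simp add: q_def)
  qed
  then have "l / 2 * (norm (y - x))\<^sup>2 \<le> J y - J x" by (rule field_le_mult_one_interval)
  then show ?thesis by simp
qed

theorem theorem2p1:
  fixes B Zad :: "'a::euclidean_space set"
    and J J\<^sub>\<theta> :: "'a \<Rightarrow> real"
    and l :: real
    and zstar zdag :: 'a
  assumes "open B"
    and "C1_on B J"
    and "l > 0"
    and "strongly_convex_on l B J"
    and "Zad \<subseteq> B" and "closed Zad" and "convex Zad" and "Zad \<noteq> {}"
    and "is_arg_min J (\<lambda>z. z \<in> Zad) zstar"
    and "C1_on B J\<^sub>\<theta>"
    and "zdag \<in> Zad"
    and "\<forall>z\<in>Zad. blinfun_apply (frechet_D J\<^sub>\<theta> zdag) (z - zdag) \<ge> 0"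
  shows "norm (zstar - zdag) \<le> 1 / l * norm (frechet_D J zdag - frechet_D J\<^sub>\<theta> zdag)
    \<and> J zdag - J zstar \<le> 1 / (2 * l) * (norm (frechet_D J zdag - frechet_D J\<^sub>\<theta> zdag))\<^sup>2"
proof -
  define d where "d = norm (zstar - zdag)"
  define E where "E = norm (frechet_D J zdag - frechet_D J\<^sub>\<theta> zdag)"
  have zs: "zstar \<in> Zad" using assms(9) by (simp add: is_arg_min_def)
  have d0: "0 \<le> d" and E0: "0 \<le> E" by (simp_all add: d_def E_def)
  have growth: "J zstar + l / 2 * d\<^sup>2 \<le> J zdag"
    using strongly_convex_on_quadratic_growth[OF assms(4,5,7,9,11)]
    by (simp add: d_def norm_minus_commute)
  have below: "J zdag + blinfun_apply (frechet_D J zdag) (zstar - zdag) + l / 2 * d\<^sup>2 \<le> J zstar"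
    using assms(4,5,11) zs unfolding strongly_convex_on_def d_def by blast
  have "\<bar>blinfun_apply (frechet_D J zdag - frechet_D J\<^sub>\<theta> zdag) (zstar - zdag)\<bar> \<le> E * d"
    using norm_blinfun[of "frechet_D J zdag - frechet_D J\<^sub>\<theta> zdag" "zstar - zdag"]
    by (simp add: d_def E_def)
  moreover have "0 \<le> blinfun_apply (frechet_D J\<^sub>\<theta> zdag) (zstar - zdag)"
    using assms(12) zs by blast
  ultimately have error: "- (E * d) \<le> blinfun_apply (frechet_D J zdag) (zstar - zdag)"
    by (simp add: blinfun.diff_left)
  \<comment> \<open>The values of \<open>J\<close> cancel in the sum of \<open>growth\<close> and
    \<open>below\<close>, and the two halves of the quadratic term combine. The factor
    \<open>d\<close> is cancelled next; if \<open>d = 0\<close>, the bound is just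
    \<open>E0\<close>.\<close>
  have "d * (l * d) \<le> d * E"
    using growth below error by (simp add: power2_eq_square algebra_simps)
  then have "l * d \<le> E" using d0 E0 by (cases "d = 0") auto
  then have "d \<le> 1 / l * E" using \<open>l > 0\<close> by (simp add: field_simps)
  moreover have "J zdag - J zstar \<le> 1 / (2 * l) * E\<^sup>2"
  proof -
    have "J zdag - J zstar \<le> E * d - l / 2 * d\<^sup>2" using below error by linarith
    \<comment> \<open>As a function of \<open>d\<close>, the left side is a concave parabola with
      its maximum at \<open>d = E / l\<close>.\<close>
    also have "\<dots> = 1 / (2 * l) * E\<^sup>2 - 1 / (2 * l) * (E - l * d)\<^sup>2"
      using \<open>l > 0\<close> by (simp add: field_simps power2_eq_square)
    also have "\<dots> \<le> 1 / (2 * l) * E\<^sup>2" using \<open>l > 0\<close> by simp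
    finally show ?thesis .
  qed
  ultimately show ?thesis by (simp add: d_def E_def)
qed

end
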